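(* Let $X$ be a Banach space and let $Y$ be an almost isometric ideal ($ai$-ideal) in $X$. If $Y$ has $BSCSP$, then $X$ has $BSCSP$.
   Context: All Banach spaces are real and nontrivial ($\neq \{0\}$); $Y$ is a closed subspace of $X$. $B_X$ is the closed unit ball of $X$. A subspace $Y$ of $X$ is an almost isometric ideal ($ai$-ideal) in $X$ if for every $\varepsilon > 0$ and every finite dimensional subspace $E \subset X$ there exists a linear operator $T : E \to Y$ such that (1) $Te = e$ for all $e \in E \cap Y$, and (2) $\frac{1}{1+\varepsilon}\|e\| \leq \|Te\| \leq (1+\varepsilon)\|e\|$ for all $e \in E$. Slices: for $f \in X^*$ with $\|f\| = 1$ and $\alpha > 0$, the set $S(B_X,f,\alpha) = \{x \in B_X : f(x) > \sup f(B_X) - \alpha\}$ is an open slice of $B_X$. A convex combination of slices of $B_X$ is a set $\sum_{i=1}^n \lambda_i S_i = \{\sum_{i=1}^n \lambda_i x_i : x_i \in S_i\}$ with $n \in \mathbb{N}$, each $S_i$ a slice of $B_X$, $\lambda_i > 0$, $\sum_{i=1}^n \lambda_i = 1$. A Banach space $X$ has $BSCSP$ (ball small combination of slices property) if for every $\varepsilon > 0$ there is a convex combination of slices of $B_X$ with (norm) diameter less than $\varepsilon$. *)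

theory Defs
  imports "HOL-Analysis.Analysis"
begin

text \<open>The ambient Banach space X is a type of class \<open>banach\<close>. A closed subspace \<open>V\<close> of X
  is a Banach space in its own right, and its geometry (unit ball, dual, slices) is
  described relative to the carrier \<open>V\<close>; X itself is the case \<open>V = UNIV\<close>. Maps defined on a
  subspace are represented by total functions of which only the values on the subspace
  matter: no definition below inspects values outside the carrier.\<close>

definition lin_map_on :: "'a::real_vector set \<Rightarrow> ('a \<Rightarrow> 'b::real_vector) \<Rightarrow> bool" where
  "lin_map_on V f \<longleftrightarrow>
     (\<forall>x\<in>V. \<forall>y\<in>V. f (x + y) = f x + f y) \<and> (\<forall>c. \<forall>x\<in>V. f (c *\<^sub>R x) = c *\<^sub>R f x)"

definition bounded_functional_on :: "'a::real_normed_vector set \<Rightarrow> ('a \<Rightarrow> real) \<Rightarrow> bool" where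
  "bounded_functional_on V f \<longleftrightarrow> lin_map_on V f \<and> (\<exists>K. \<forall>x\<in>V. \<bar>f x\<bar> \<le> K * norm x)"

definition unit_ball_on :: "'a::real_normed_vector set \<Rightarrow> 'a set" where
  "unit_ball_on V = {x \<in> V. norm x \<le> 1}"

definition dual_norm_on :: "'a::real_normed_vector set \<Rightarrow> ('a \<Rightarrow> real) \<Rightarrow> real" where
  "dual_norm_on V f = (SUP x\<in>unit_ball_on V. \<bar>f x\<bar>)"

definition slice_on ::
  "'a::real_normed_vector set \<Rightarrow> ('a \<Rightarrow> real) \<Rightarrow> real \<Rightarrow> 'a set" where
  "slice_on V f \<alpha> = {x \<in> unit_ball_on V. f x > (SUP y\<in>unit_ball_on V. f y) - \<alpha>}"

definition is_slice_on :: "'a::real_normed_vector set \<Rightarrow> 'a set \<Rightarrow> bool" where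
  "is_slice_on V S \<longleftrightarrow>
     (\<exists>f \<alpha>. bounded_functional_on V f \<and> dual_norm_on V f = 1 \<and> \<alpha> > 0 \<and> S = slice_on V f \<alpha>)"

definition convex_combination_of_slices_on ::
  "'a::real_normed_vector set \<Rightarrow> 'a set \<Rightarrow> bool" where
  "convex_combination_of_slices_on V C \<longleftrightarrow>
     (\<exists>(n::nat) (l :: nat \<Rightarrow> real) (S :: nat \<Rightarrow> 'a set).
        (\<forall>i<n. is_slice_on V (S i)) \<and> (\<forall>i<n. l i > 0) \<and> (\<Sum>i<n. l i) = 1 \<and>
        C = {(\<Sum>i<n. l i *\<^sub>R x i) | x. \<forall>i<n. x i \<in> S i})"

definition BSCSP_on :: "'a::real_normed_vector set \<Rightarrow> bool" where
  "BSCSP_on V \<longleftrightarrow>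
     (\<forall>\<epsilon>>0. \<exists>C. convex_combination_of_slices_on V C \<and> diameter C < \<epsilon>)"

definition finite_dim_subspace :: "'a::real_vector set \<Rightarrow> bool" where
  "finite_dim_subspace E \<longleftrightarrow> (\<exists>B. finite B \<and> E = span B)"

definition ai_ideal :: "'a::real_normed_vector set \<Rightarrow> bool" where
  "ai_ideal Y \<longleftrightarrow>
     (\<forall>\<epsilon>>0. \<forall>E. finite_dim_subspace E \<longrightarrow>
        (\<exists>T :: 'a \<Rightarrow> 'a. lin_map_on E T \<and> T ` E \<subseteq> Y \<and>
           (\<forall>e \<in> E \<inter> Y. T e = e) \<and>
           (\<forall>e\<in>E. 1 / (1 + \<epsilon>) * norm e \<le> norm (T e) \<and> norm (T e) \<le> (1 + \<epsilon>) * norm e)))"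

text \<open>For the whole space, the relative dual is the usual one with the operator norm.\<close>

lemma bounded_functional_on_UNIV:
  "bounded_functional_on UNIV f \<longleftrightarrow> bounded_linear f"
proof
  assume "bounded_functional_on UNIV f"
  then obtain K where "lin_map_on UNIV f" and K: "\<And>x. \<bar>f x\<bar> \<le> K * norm x"
    unfolding bounded_functional_on_def by auto
  then show "bounded_linear f"
    by (intro bounded_linear_intro[where K = K]) (auto simp: lin_map_on_def mult.commute)
next
  assume f: "bounded_linear f"
  then have "\<forall>x. \<bar>f x\<bar> \<le> onorm f * norm x"
    using onorm[OF f] by simp
  with f show "bounded_functional_on UNIV f"
    unfolding bounded_functional_on_def lin_map_on_def
    by (auto simp: linear_simps)
qed

lemma dual_norm_on_UNIV:
  assumes f: "bounded_linear f"
  shows "dual_norm_on UNIV f = onorm f"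
proof (rule antisym)
  have le: "\<bar>f x\<bar> \<le> onorm f" if "norm x \<le> 1" for x
  proof -
    have "\<bar>f x\<bar> \<le> onorm f * norm x"
      using onorm[OF f, of x] by simp
    also have "\<dots> \<le> onorm f"
      using that onorm_pos_le[OF f] by (simp add: mult_left_le)
    finally show ?thesis .
  qed
  have "(0::'a) \<in> unit_ball_on UNIV"
    by (simp add: unit_ball_on_def)
  then show "dual_norm_on UNIV f \<le> onorm f"
    unfolding dual_norm_on_def
    by (intro cSUP_least le) (blast, simp add: unit_ball_on_def)
  have bdd: "bdd_above ((\<lambda>x. \<bar>f x\<bar>) ` unit_ball_on UNIV)"
    using le by (intro bdd_aboveI2[where M = "onorm f"]) (simp add: unit_ball_on_def)
  show "onorm f \<le> dual_norm_on UNIV f"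
  proof (rule onorm_bound)
    have "\<bar>f 0\<bar> \<le> dual_norm_on UNIV f"
      unfolding dual_norm_on_def
      by (intro cSUP_upper bdd) (simp add: unit_ball_on_def)
    then show "0 \<le> dual_norm_on UNIV f"
      by linarith
  next
    fix x
    show "norm (f x) \<le> dual_norm_on UNIV f * norm x"
    proof (cases "x = 0")
      case True
      then show ?thesis using f by (simp add: linear_simps)
    next
      case False
      have "\<bar>f (x /\<^sub>R norm x)\<bar> \<le> dual_norm_on UNIV f"
        unfolding dual_norm_on_def
        by (intro cSUP_upper bdd) (simp add: unit_ball_on_def False)
      then show ?thesis
        using False by (simp add: linear_simps[OF f] abs_mult field_simps)
    qed
  qed
qed

end

theory Submission
  imports Defs
begin

text \<open>Norm-one functionals \<open>f\<^sub>1, \<dots>, f\<^sub>n\<close> on \<open>Y\<close> that define a small convex combination of slices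
  are extended to \<open>X\<close> so that the same weights and widths give an equally small combination of
  slices of the ball of \<open>X\<close>. The extensions have to be compatible with the local operators
  \<open>T\<close> that witness the ideal property; an arbitrary Hahn-Banach extension would not do. They
  are obtained as limits \<open>g\<^sub>i x = lim f\<^sub>i (T x)\<close>, where \<open>T\<close> runs along a filter on which \<open>T\<close>
  is eventually defined on any given finite dimensional subspace, fixes its intersection with
  \<open>Y\<close>, and is isometric up to any given factor. By Tychonoff's theorem such a filter can be
  refined so that all these limits exist (\<open>ai_ideal_limits\<close>). Since \<open>T\<close> becomes linear,
  almost contractive and the identity on \<open>Y\<close>, each \<open>g\<^sub>i\<close> is a norm-preserving extension
  of \<open>f\<^sub>i\<close> (\<open>limit_functional_norm_preserving_extension\<close>).

  Given two points of the combination of slices in \<open>X\<close>, only finitely many points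
  of the ball of \<open>X\<close> are involved. A single \<open>T\<close> far enough along the filter carries them,
  after a harmless rescaling, into the corresponding slices of the ball of \<open>Y\<close> and almost
  preserves the distance of the two combinations. Hence the diameter in \<open>X\<close> is at most the
  diameter in \<open>Y\<close> (\<open>diameter_combination_le\<close>). For this it suffices that \<open>f\<^sub>i (T x)\<close> is close
  to \<open>g\<^sub>i x\<close> at the points in question, so limits can replace the exact identity
  \<open>f\<^sub>i \<circ> T = g\<^sub>i\<close>.\<close>

section \<open>Functionals on a subspace\<close>

lemma bdd_above_functional_on_ball:
  assumes "bounded_functional_on V f"
  shows "bdd_above ((\<lambda>x. \<bar>f x\<bar>) ` unit_ball_on V)"
proof -
  obtain K where K: "\<And>x. x \<in> V \<Longrightarrow> \<bar>f x\<bar> \<le> K * norm x"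
    using assms unfolding bounded_functional_on_def by auto
  have "\<bar>f x\<bar> \<le> \<bar>K\<bar>" if "x \<in> unit_ball_on V" for x
  proof -
    have "\<bar>f x\<bar> \<le> K * norm x"
      using that K by (simp add: unit_ball_on_def)
    also have "\<dots> \<le> \<bar>K\<bar> * 1"
      using that by (intro mult_mono) (auto simp: unit_ball_on_def)
    finally show ?thesis by simp
  qed
  then show ?thesis
    by (rule bdd_aboveI2)
qed

lemma abs_le_dual_norm_on:
  assumes V: "subspace V" and f: "bounded_functional_on V f" and x: "x \<in> V"
  shows "\<bar>f x\<bar> \<le> dual_norm_on V f * norm x"
proof -
  have lin: "f (c *\<^sub>R x) = c * f x" for c
    using f x unfolding bounded_functional_on_def lin_map_on_def by simp
  show ?thesis
  proof (cases "x = 0")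
    case True
    with lin[of 0] show ?thesis by simp
  next
    case False
    have "\<bar>f (inverse (norm x) *\<^sub>R x)\<bar> \<le> dual_norm_on V f"
      unfolding dual_norm_on_def using V x False
      by (intro cSUP_upper bdd_above_functional_on_ball[OF f])
        (simp add: unit_ball_on_def subspace_scale)
    then show ?thesis
      using False by (simp add: lin abs_mult field_simps)
  qed
qed

text \<open>The unit ball is symmetric, so a functional of norm one has supremum one on it and a
  slice is cut out by the explicit threshold \<open>1 - \<alpha>\<close>. A functional and a norm-preserving
  extension of it therefore share their thresholds.\<close>

lemma slice_on_eq:
  assumes V: "subspace V" and f: "bounded_functional_on V f" and nf: "dual_norm_on V f = 1"
  shows "slice_on V f \<alpha> = {x \<in> unit_ball_on V. 1 - \<alpha> < f x}"
proof -
  have bdd: "bdd_above (f ` unit_ball_on V)"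
    by (rule bdd_aboveI2[where M = 1])
      (use abs_le_dual_norm_on[OF V f] nf in \<open>force simp: unit_ball_on_def\<close>)
  have ne: "unit_ball_on V \<noteq> {}"
    using subspace_0[OF V] by (auto simp: unit_ball_on_def)
  have neg: "- x \<in> unit_ball_on V \<and> f (- x) = - f x" if "x \<in> unit_ball_on V" for x
  proof -
    have "f ((-1) *\<^sub>R x) = (-1) *\<^sub>R f x"
      using f that unfolding bounded_functional_on_def lin_map_on_def unit_ball_on_def by blast
    then show ?thesis
      using that V by (simp add: unit_ball_on_def subspace_neg)
  qed
  have "(SUP y\<in>unit_ball_on V. f y) = dual_norm_on V f"
    unfolding dual_norm_on_def
  proof (rule antisym)
    show "(SUP y\<in>unit_ball_on V. f y) \<le> (SUP y\<in>unit_ball_on V. \<bar>f y\<bar>)"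
      by (rule cSUP_mono[OF ne bdd_above_functional_on_ball[OF f]]) (meson abs_ge_self)
    have "\<bar>f x\<bar> \<le> (SUP y\<in>unit_ball_on V. f y)" if "x \<in> unit_ball_on V" for x
    proof -
      have "f x \<le> (SUP y\<in>unit_ball_on V. f y)" "f (- x) \<le> (SUP y\<in>unit_ball_on V. f y)"
        using that neg[OF that] by (intro cSUP_upper bdd; simp)+
      then show ?thesis
        using neg[OF that] by linarith
    qed
    then show "(SUP y\<in>unit_ball_on V. \<bar>f y\<bar>) \<le> (SUP y\<in>unit_ball_on V. f y)"
      by (rule cSUP_least[OF ne])
  qed
  then show ?thesis
    by (simp add: slice_on_def nf)
qed

section \<open>A filter of almost isometric operators\<close>

definition ai_operators :: "'a::real_normed_vector set \<Rightarrow> 'a set \<Rightarrow> real \<Rightarrow> ('a \<Rightarrow> 'a) set" where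
  "ai_operators Y E \<epsilon> = {T. lin_map_on E T \<and> T ` E \<subseteq> Y \<and> (\<forall>e \<in> E \<inter> Y. T e = e) \<and>
     (\<forall>e\<in>E. 1 / (1 + \<epsilon>) * norm e \<le> norm (T e) \<and> norm (T e) \<le> (1 + \<epsilon>) * norm e)}"

lemma ai_operators_mono:
  assumes "E \<subseteq> E'" "0 < \<epsilon>'" "\<epsilon>' \<le> \<epsilon>"
  shows "ai_operators Y E' \<epsilon>' \<subseteq> ai_operators Y E \<epsilon>"
proof
  fix T assume T: "T \<in> ai_operators Y E' \<epsilon>'"
  have "1 / (1 + \<epsilon>) * norm e \<le> norm (T e) \<and> norm (T e) \<le> (1 + \<epsilon>) * norm e" if "e \<in> E" for e
  proof -
    have T': "1 / (1 + \<epsilon>') * norm e \<le> norm (T e)" "norm (T e) \<le> (1 + \<epsilon>') * norm e"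
      using T that assms(1) by (auto simp: ai_operators_def)
    have "1 / (1 + \<epsilon>) * norm e \<le> 1 / (1 + \<epsilon>') * norm e"
      using assms by (intro mult_right_mono divide_left_mono) auto
    moreover have "(1 + \<epsilon>') * norm e \<le> (1 + \<epsilon>) * norm e"
      using assms by (intro mult_right_mono) auto
    ultimately show ?thesis
      using T' by linarith
  qed
  then show "T \<in> ai_operators Y E \<epsilon>"
    using T assms(1) unfolding ai_operators_def lin_map_on_def by blast
qed

lemma finite_dim_subspace_span: "finite B \<Longrightarrow> finite_dim_subspace (span B)"
  by (auto simp: finite_dim_subspace_def)

text \<open>Passing to larger subspaces and smaller \<open>\<epsilon>\<close> is a directed process, so all the
  approximation requirements can be met together along a single proper filter.\<close>

lemma ai_ideal_filter:
  assumes "ai_ideal Y"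
  obtains F :: "('a::real_normed_vector \<Rightarrow> 'a) filter" where "F \<noteq> bot"
    "\<And>E \<epsilon>. \<lbrakk>finite_dim_subspace E; \<epsilon> > 0\<rbrakk> \<Longrightarrow> \<forall>\<^sub>F T in F. T \<in> ai_operators Y E \<epsilon>"
proof -
  define I where "I = {(E :: 'a set, \<epsilon> :: real). finite_dim_subspace E \<and> 0 < \<epsilon>}"
  define P where "P = (\<lambda>(E, \<epsilon>). principal (ai_operators Y E \<epsilon>))"
  define F where "F = (INF i\<in>I. P i)"
  have "(span {}, 1) \<in> I"
    by (auto simp: I_def simp del: span_empty intro: finite_dim_subspace_span)
  then have I: "I \<noteq> {}"
    by blast
  have directed: "\<exists>k\<in>I. P k \<le> inf (P i) (P j)" if ij: "i \<in> I" "j \<in> I" for i j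
  proof -
    obtain A \<delta> where i: "i = (span A, \<delta>)" "finite A" "\<delta> > 0"
      using ij(1) unfolding I_def finite_dim_subspace_def by auto
    obtain B \<epsilon> where j: "j = (span B, \<epsilon>)" "finite B" "\<epsilon> > 0"
      using ij(2) unfolding I_def finite_dim_subspace_def by auto
    have "ai_operators Y (span (A \<union> B)) (min \<delta> \<epsilon>) \<subseteq> ai_operators Y (span A) \<delta>"
      "ai_operators Y (span (A \<union> B)) (min \<delta> \<epsilon>) \<subseteq> ai_operators Y (span B) \<epsilon>"
      using i j by (intro ai_operators_mono span_mono; simp)+
    moreover have "(span (A \<union> B), min \<delta> \<epsilon>) \<in> I"
      using i j by (auto simp: I_def intro: finite_dim_subspace_span)
    ultimately show ?thesis
      by (intro bexI[of _ "(span (A \<union> B), min \<delta> \<epsilon>)"]) (auto simp: P_def i j)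
  qed
  have ne: "ai_operators Y E \<epsilon> \<noteq> {}" if "(E, \<epsilon>) \<in> I" for E \<epsilon>
    using assms that unfolding ai_ideal_def ai_operators_def I_def by blast
  show thesis
  proof
    show "F \<noteq> bot"
    proof
      assume "F = bot"
      then have "\<forall>\<^sub>F T in INF i\<in>I. P i. False"
        by (simp add: F_def trivial_limit_def)
      then obtain E \<epsilon> where "(E, \<epsilon>) \<in> I" "\<forall>\<^sub>F T in P (E, \<epsilon>). False"
        using eventually_INF_base[where F = P, OF I directed] by auto
      with ne show False
        by (auto simp: P_def eventually_principal)
    qed
    show "\<forall>\<^sub>F T in F. T \<in> ai_operators Y E \<epsilon>" if "finite_dim_subspace E" "\<epsilon> > 0" for E \<epsilon>
      unfolding F_def using that
      by (intro eventually_INF1[of "(E, \<epsilon>)"]) (auto simp: I_def P_def eventually_principal)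
  qed
qed

text \<open>This is Tychonoff's theorem for the values \<open>f (T x)\<close>. They are bounded only once \<open>x\<close>
  lies in the subspace on which \<open>T\<close> is controlled; clipping them to \<open>[-2 \<parallel>x\<parallel>, 2 \<parallel>x\<parallel>]\<close> puts
  every evaluation map into one compact product without changing its limits.\<close>

lemma ai_ideal_limits:
  assumes "ai_ideal Y"
  obtains G :: "('a::real_normed_vector \<Rightarrow> 'a) filter" and \<phi> :: "('a \<Rightarrow> real) \<Rightarrow> 'a \<Rightarrow> real"
    where "G \<noteq> bot"
      "\<And>E \<epsilon>. \<lbrakk>finite_dim_subspace E; \<epsilon> > 0\<rbrakk> \<Longrightarrow> \<forall>\<^sub>F T in G. T \<in> ai_operators Y E \<epsilon>"
      "\<And>f x. (\<And>y. y \<in> Y \<Longrightarrow> \<bar>f y\<bar> \<le> norm y) \<Longrightarrow> ((\<lambda>T. f (T x)) \<longlongrightarrow> \<phi> f x) G"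
proof -
  obtain F :: "('a \<Rightarrow> 'a) filter" where F: "F \<noteq> bot"
    and evF: "\<And>E \<epsilon>. \<lbrakk>finite_dim_subspace E; \<epsilon> > 0\<rbrakk> \<Longrightarrow> \<forall>\<^sub>F T in F. T \<in> ai_operators Y E \<epsilon>"
    using ai_ideal_filter[OF assms] by blast
  define clip where
    "clip = (\<lambda>T. \<lambda>(f :: 'a \<Rightarrow> real, x :: 'a). max (- 2 * norm x) (min (2 * norm x) (f (T x))))"
  define K where "K = (\<Pi>\<^sub>E (f :: 'a \<Rightarrow> real, x :: 'a)\<in>UNIV. {- 2 * norm x .. 2 * norm x})"
  have "compactin (product_topology (\<lambda>_. euclidean) UNIV) K"
    unfolding K_def by (subst compactin_PiE) auto
  then have "compact K"
    by (simp add: euclidean_product_topology)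
  moreover have "\<forall>\<^sub>F g in filtermap clip F. g \<in> K"
    by (auto simp: eventually_filtermap K_def clip_def PiE_UNIV_domain intro!: always_eventually)
  moreover have "filtermap clip F \<noteq> bot"
    using F by (simp add: filtermap_bot_iff)
  ultimately obtain g where g: "inf (nhds g) (filtermap clip F) \<noteq> bot"
    unfolding compact_filter by blast
  \<comment> \<open>The cluster point \<open>g\<close> becomes a limit along the trace of \<open>F\<close> on the clip-preimages of
    its neighbourhoods.\<close>
  define G where "G = inf (filtercomap clip (nhds g)) F"
  have GF: "G \<le> F"
    by (simp add: G_def)
  have clip_lim: "((\<lambda>T. clip T (f, x)) \<longlongrightarrow> g (f, x)) G" for f x
  proof -
    have "filterlim clip (nhds g) G"
      unfolding G_def by (rule filterlim_mono[OF filterlim_filtercomap]) auto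
    with continuous_on_product_coordinates[of "(f, x)"] show ?thesis
      by (rule continuous_on_tendsto_compose) auto
  qed
  show thesis
  proof
    show "G \<noteq> bot"
    proof
      assume "G = bot"
      then have "\<forall>\<^sub>F T in G. False"
        by simp
      then obtain P Q where "eventually P (nhds g)" "eventually Q F" "\<And>T. P (clip T) \<Longrightarrow> \<not> Q T"
        unfolding G_def eventually_inf eventually_filtercomap by blast
      then have "\<forall>\<^sub>F h in inf (nhds g) (filtermap clip F). False"
        unfolding eventually_inf eventually_filtermap
        by (intro exI[of _ P] exI[of _ "\<lambda>h. \<not> P h"]) (auto elim: eventually_mono)
      with g show False
        by (simp add: trivial_limit_def)
    qed
    show evG: "\<forall>\<^sub>F T in G. T \<in> ai_operators Y E \<epsilon>" if "finite_dim_subspace E" "\<epsilon> > 0" for E \<epsilon>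
      using evF[OF that] GF by (rule filter_leD[rotated])
    fix f :: "'a \<Rightarrow> real" and x :: 'a
    assume f: "\<And>y. y \<in> Y \<Longrightarrow> \<bar>f y\<bar> \<le> norm y"
    have "\<forall>\<^sub>F T in G. T \<in> ai_operators Y (span {x}) 1"
      by (rule evG) (auto intro: finite_dim_subspace_span)
    then have "\<forall>\<^sub>F T in G. clip T (f, x) = f (T x)"
    proof eventually_elim
      case (elim T)
      then have "T x \<in> Y" "norm (T x) \<le> 2 * norm x"
        by (auto simp: ai_operators_def span_base)
      with f[of "T x"] show ?case
        by (auto simp: clip_def)
    qed
    then show "((\<lambda>T. f (T x)) \<longlongrightarrow> curry g f x) G"
      using clip_lim[of f x] by (auto intro: Lim_transform_eventually)
  qed
qed

section \<open>The limits as extensions of functionals\<close>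

text \<open>Each algebraic identity and each estimate for \<open>g\<close> involves at most two points, whose span
  is eventually in the control of \<open>T\<close>, and so passes to the limit. The norm of \<open>g\<close> cannot
  drop below that of \<open>f\<close> because \<open>T y = y\<close> eventually for each \<open>y\<close> in \<open>Y\<close>.\<close>

lemma limit_functional_norm_preserving_extension:
  fixes Y :: "'a::real_normed_vector set"
  assumes Y: "subspace Y" and f: "bounded_functional_on Y f" and nf: "dual_norm_on Y f = 1"
    and G: "G \<noteq> bot"
    and ev: "\<And>E \<epsilon>. \<lbrakk>finite_dim_subspace E; \<epsilon> > 0\<rbrakk> \<Longrightarrow> \<forall>\<^sub>F T in G. T \<in> ai_operators Y E \<epsilon>"
    and lim: "\<And>x. ((\<lambda>T. f (T x)) \<longlongrightarrow> g x) G"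
  shows "bounded_functional_on UNIV g" "dual_norm_on UNIV g = 1"
proof -
  have fle: "\<bar>f y\<bar> \<le> norm y" if "y \<in> Y" for y
    using abs_le_dual_norm_on[OF Y f that] nf by simp
  have fadd: "f (x + y) = f x + f y" if "x \<in> Y" "y \<in> Y" for x y
    using f that unfolding bounded_functional_on_def lin_map_on_def by blast
  have fscale: "f (c *\<^sub>R x) = c * f x" if "x \<in> Y" for c x
    using f that unfolding bounded_functional_on_def lin_map_on_def by simp
  have evs: "\<forall>\<^sub>F T in G. T \<in> ai_operators Y (span {x, y}) \<epsilon>" if "\<epsilon> > 0" for x y \<epsilon>
    using that by (intro ev finite_dim_subspace_span) auto
  have add: "g (x + y) = g x + g y" for x y
  proof (rule tendsto_unique[OF G])
    have "\<forall>\<^sub>F T in G. f (T x) + f (T y) = f (T (x + y))"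
      using evs[OF zero_less_one, of x y]
    proof eventually_elim
      case (elim T)
      have "x \<in> span {x, y}" "y \<in> span {x, y}"
        by (auto intro: span_base)
      then have "T (x + y) = T x + T y" "T x \<in> Y" "T y \<in> Y"
        using elim unfolding ai_operators_def lin_map_on_def by blast+
      then show ?case
        by (simp add: fadd)
    qed
    then show "((\<lambda>T. f (T (x + y))) \<longlongrightarrow> g x + g y) G"
      by (rule Lim_transform_eventually[rotated]) (intro tendsto_add lim)
  qed (rule lim)
  have scale: "g (c *\<^sub>R x) = c * g x" for c x
  proof (rule tendsto_unique[OF G])
    have "\<forall>\<^sub>F T in G. c * f (T x) = f (T (c *\<^sub>R x))"
      using evs[OF zero_less_one, of x x]
    proof eventually_elim
      case (elim T)
      have "x \<in> span {x, x}"
        by (auto intro: span_base)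
      then have "T (c *\<^sub>R x) = c *\<^sub>R T x" "T x \<in> Y"
        using elim unfolding ai_operators_def lin_map_on_def by blast+
      then show ?case
        by (simp add: fscale)
    qed
    then show "((\<lambda>T. f (T (c *\<^sub>R x))) \<longlongrightarrow> c * g x) G"
      by (rule Lim_transform_eventually[rotated]) (intro tendsto_mult tendsto_const lim)
  qed (rule lim)
  have gle: "\<bar>g x\<bar> \<le> norm x" for x
  proof -
    have "\<bar>g x\<bar> \<le> (1 + \<epsilon>) * norm x" if "\<epsilon> > 0" for \<epsilon>
    proof (rule tendsto_upperbound[OF tendsto_rabs[OF lim] _ G])
      show "\<forall>\<^sub>F T in G. \<bar>f (T x)\<bar> \<le> (1 + \<epsilon>) * norm x"
        using evs[OF that, of x x]
      proof eventually_elim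
        case (elim T)
        have "x \<in> span {x, x}"
          by (auto intro: span_base)
        then have "T x \<in> Y" "norm (T x) \<le> (1 + \<epsilon>) * norm x"
          using elim by (auto simp: ai_operators_def)
        then show ?case
          using fle[of "T x"] by linarith
      qed
    qed
    then have "\<forall>\<^sub>F \<epsilon> in at_right 0. \<bar>g x\<bar> \<le> (1 + \<epsilon>) * norm x"
      by (auto simp: eventually_at_right_less eventually_at_filter)
    moreover have "((\<lambda>\<epsilon>. (1 + \<epsilon>) * norm x) \<longlongrightarrow> (1 + 0) * norm x) (at_right (0::real))"
      by (intro tendsto_intros)
    ultimately have "\<bar>g x\<bar> \<le> (1 + 0) * norm x"
      by (intro tendsto_lowerbound) auto
    then show ?thesis by simp
  qed
  have ext: "g y = f y" if "y \<in> Y" for y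
  proof (rule tendsto_unique[OF G lim])
    have "\<forall>\<^sub>F T in G. f y = f (T y)"
      using evs[OF zero_less_one, of y y]
      by eventually_elim (use that in \<open>auto simp: ai_operators_def span_base\<close>)
    then show "((\<lambda>T. f (T y)) \<longlongrightarrow> f y) G"
      by (rule Lim_transform_eventually[OF tendsto_const])
  qed
  show bg: "bounded_functional_on UNIV g"
    unfolding bounded_functional_on_def lin_map_on_def
    using add scale gle by (auto intro!: exI[of _ 1])
  show "dual_norm_on UNIV g = 1"
  proof (rule antisym)
    have "unit_ball_on UNIV \<noteq> ({} :: 'a set)"
      by (auto simp: unit_ball_on_def intro!: exI[of _ 0])
    moreover have "\<bar>g x\<bar> \<le> 1" if "x \<in> unit_ball_on UNIV" for x
      using gle[of x] that by (simp add: unit_ball_on_def)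
    ultimately show "dual_norm_on UNIV g \<le> 1"
      unfolding dual_norm_on_def by (rule cSUP_least)
    have "dual_norm_on Y f \<le> dual_norm_on UNIV g"
      unfolding dual_norm_on_def
    proof (rule cSUP_mono)
      show "unit_ball_on Y \<noteq> {}"
        using subspace_0[OF Y] by (auto simp: unit_ball_on_def)
      show "bdd_above ((\<lambda>x. \<bar>g x\<bar>) ` unit_ball_on UNIV)"
        by (rule bdd_above_functional_on_ball[OF bg])
    qed (use ext in \<open>force simp: unit_ball_on_def\<close>)
    with nf show "1 \<le> dual_norm_on UNIV g"
      by simp
  qed
qed

section \<open>Comparing convex combinations of slices\<close>

lemma lin_map_on_sum:
  assumes V: "subspace V" and T: "lin_map_on V T" and "finite A" "\<And>i. i \<in> A \<Longrightarrow> x i \<in> V"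
  shows "T (\<Sum>i\<in>A. l i *\<^sub>R x i) = (\<Sum>i\<in>A. l i *\<^sub>R T (x i))"
  using assms(3,4)
proof (induction A rule: finite_induct)
  case empty
  have "T (0 *\<^sub>R 0) = 0 *\<^sub>R T 0"
    using T subspace_0[OF V] unfolding lin_map_on_def by blast
  then show ?case by simp
next
  case (insert a A)
  have "(\<Sum>i\<in>A. l i *\<^sub>R x i) \<in> V" "l a *\<^sub>R x a \<in> V" "x a \<in> V"
    using insert.prems V by (auto intro!: subspace_sum subspace_scale)
  with insert T show ?case
    by (simp add: lin_map_on_def)
qed

lemma bounded_combinations_of_unit_ball:
  assumes "\<And>i. i < n \<Longrightarrow> S i \<subseteq> unit_ball_on V"
  shows "bounded {(\<Sum>i<(n::nat). l i *\<^sub>R x i) | x. \<forall>i<n. x i \<in> S i}"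
proof -
  have "norm (\<Sum>i<n. l i *\<^sub>R x i) \<le> (\<Sum>i<n. \<bar>l i\<bar>)" if "\<forall>i<n. x i \<in> S i" for x
  proof (rule order_trans[OF norm_sum sum_mono])
    fix i assume "i \<in> {..<n}"
    then have "norm (x i) \<le> 1"
      using that assms by (force simp: unit_ball_on_def)
    then show "norm (l i *\<^sub>R x i) \<le> \<bar>l i\<bar>"
      by (simp add: mult_left_le)
  qed
  then show ?thesis
    by (auto simp: bounded_iff)
qed

text \<open>Given two points of the combination in the big space, all the slice points involved are
  moved into \<open>Y\<close> by one operator \<open>T\<close>. Since \<open>T\<close> may enlarge norms, the images are divided by
  \<open>1 + \<delta>\<close>; because slices are open, the images still clear the thresholds \<open>c i\<close> when \<open>\<delta>\<close> is
  small. Both the rescaling and the lower estimate for \<open>T\<close> cost a factor \<open>1 + \<delta>\<close>, and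
  \<open>\<delta> \<rightarrow> 0\<close>.\<close>

lemma diameter_combination_le:
  fixes Y :: "'a::real_normed_vector set" and n :: nat and f g :: "nat \<Rightarrow> 'a \<Rightarrow> real"
  assumes Y: "subspace Y" and lin: "\<And>i. i < n \<Longrightarrow> lin_map_on Y (f i)"
    and G: "G \<noteq> bot"
    and ev: "\<And>E \<epsilon>. \<lbrakk>finite_dim_subspace E; \<epsilon> > 0\<rbrakk> \<Longrightarrow> \<forall>\<^sub>F T in G. T \<in> ai_operators Y E \<epsilon>"
    and lim: "\<And>i x. i < n \<Longrightarrow> ((\<lambda>T. f i (T x)) \<longlongrightarrow> g i x) G"
    and C: "C = {(\<Sum>i<n. l i *\<^sub>R y i) | y. \<forall>i<n. y i \<in> {y \<in> unit_ball_on Y. c i < f i y}}"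
    and D: "D = {(\<Sum>i<n. l i *\<^sub>R x i) | x. \<forall>i<n. x i \<in> {x \<in> unit_ball_on UNIV. c i < g i x}}"
  shows "diameter D \<le> diameter C"
proof (rule diameter_le)
  have bC: "bounded C"
    unfolding C by (rule bounded_combinations_of_unit_ball[where V = Y]) auto
  show "D \<noteq> {} \<or> 0 \<le> diameter C"
    using diameter_ge_0[OF bC] by simp
  fix z w assume "z \<in> D" "w \<in> D"
  then obtain x x' where z: "z = (\<Sum>i<n. l i *\<^sub>R x i)" and w: "w = (\<Sum>i<n. l i *\<^sub>R x' i)"
    and x: "\<And>i. i < n \<Longrightarrow> norm (x i) \<le> 1" "\<And>i. i < n \<Longrightarrow> c i < g i (x i)"
    and x': "\<And>i. i < n \<Longrightarrow> norm (x' i) \<le> 1" "\<And>i. i < n \<Longrightarrow> c i < g i (x' i)"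
    unfolding D by (auto simp: unit_ball_on_def)
  define E where "E = span (x ` {..<n} \<union> x' ` {..<n})"
  have E: "finite_dim_subspace E" "subspace E"
    by (auto simp: E_def intro: finite_dim_subspace_span)
  have inE: "x i \<in> E" "x' i \<in> E" if "i < n" for i
    using that by (auto simp: E_def intro!: span_base)
  have zw: "z \<in> E" "w \<in> E"
    using inE E(2) by (auto simp: z w intro!: subspace_sum subspace_scale)
  have bound: "norm (z - w) \<le> (1 + \<delta>) * ((1 + \<delta>) * diameter C)"
    if \<delta>: "\<delta> > 0" and less: "\<forall>i<n. (1 + \<delta>) * c i < g i (x i) \<and> (1 + \<delta>) * c i < g i (x' i)" for \<delta>
  proof -
    have "\<forall>\<^sub>F T in G. \<forall>i\<in>{..<n}. (1 + \<delta>) * c i < f i (T (x i)) \<and> (1 + \<delta>) * c i < f i (T (x' i))"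
      using less by (intro eventually_ball_finite ballI eventually_conj order_tendstoD[OF lim]) auto
    then have "\<forall>\<^sub>F T in G. T \<in> ai_operators Y E \<delta> \<and>
        (\<forall>i\<in>{..<n}. (1 + \<delta>) * c i < f i (T (x i)) \<and> (1 + \<delta>) * c i < f i (T (x' i)))"
      by (intro eventually_conj ev E \<delta>)
    then obtain T where T: "T \<in> ai_operators Y E \<delta>"
      and Tc: "\<And>i. i < n \<Longrightarrow> (1 + \<delta>) * c i < f i (T (x i))"
        "\<And>i. i < n \<Longrightarrow> (1 + \<delta>) * c i < f i (T (x' i))"
      using eventually_happens'[OF G] by blast
    have linT: "lin_map_on E T" and TY: "\<And>e. e \<in> E \<Longrightarrow> T e \<in> Y"
      and Tge: "\<And>e. e \<in> E \<Longrightarrow> 1 / (1 + \<delta>) * norm e \<le> norm (T e)"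
      and Tle: "\<And>e. e \<in> E \<Longrightarrow> norm (T e) \<le> (1 + \<delta>) * norm e"
      using T by (auto simp: ai_operators_def)
    \<comment> \<open>\<open>s T\<close> maps the part of the unit ball in \<open>E\<close> into the unit ball of \<open>Y\<close>.\<close>
    define s where "s = inverse (1 + \<delta>)"
    have s: "s > 0"
      using \<delta> by (simp add: s_def)
    have inC: "s *\<^sub>R T (\<Sum>i<n. l i *\<^sub>R u i) \<in> C"
      if u: "\<And>i. i < n \<Longrightarrow> u i \<in> E" "\<And>i. i < n \<Longrightarrow> norm (u i) \<le> 1"
        and fu: "\<And>i. i < n \<Longrightarrow> (1 + \<delta>) * c i < f i (T (u i))" for u
    proof -
      have "s *\<^sub>R T (u i) \<in> unit_ball_on Y \<and> c i < f i (s *\<^sub>R T (u i))" if i: "i < n" for i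
      proof -
        have "norm (T (u i)) \<le> (1 + \<delta>) * norm (u i)"
          using Tle u(1) i by blast
        also have "\<dots> \<le> (1 + \<delta>) * 1"
          using u(2)[OF i] \<delta> by (intro mult_left_mono) auto
        finally have "norm (s *\<^sub>R T (u i)) \<le> 1"
          using \<delta> by (simp add: s_def field_simps)
        moreover have "s *\<^sub>R T (u i) \<in> Y"
          using Y TY u(1) i by (simp add: subspace_scale)
        moreover have "f i (s *\<^sub>R T (u i)) = s * f i (T (u i))"
          using lin[OF i] TY u(1) i by (simp add: lin_map_on_def)
        moreover have "c i < s * f i (T (u i))"
          using fu[OF i] \<delta> by (simp add: s_def field_simps)
        ultimately show ?thesis
          by (simp add: unit_ball_on_def)
      qed
      moreover have "s *\<^sub>R T (\<Sum>i<n. l i *\<^sub>R u i) = (\<Sum>i<n. l i *\<^sub>R (s *\<^sub>R T (u i)))"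
        using u(1) by (subst lin_map_on_sum[OF E(2) linT])
          (auto simp: scaleR_sum_right mult.commute)
      ultimately show ?thesis
        unfolding C by (intro CollectI exI[of _ "\<lambda>i. s *\<^sub>R T (u i)"]) auto
    qed
    have "T (z + (-1) *\<^sub>R w) = T z + (-1) *\<^sub>R T w"
      using linT zw E(2) unfolding lin_map_on_def by (metis subspace_scale)
    then have Tdiff: "T (z - w) = T z - T w"
      by simp
    have "s *\<^sub>R T z \<in> C" "s *\<^sub>R T w \<in> C"
      unfolding z w using inE x x' Tc by (auto intro!: inC)
    from diameter_bounded_bound[OF bC this]
    have "norm (s *\<^sub>R (T z - T w)) \<le> diameter C"
      by (simp only: dist_norm scaleR_diff_right)
    then have "s * norm (T z - T w) \<le> diameter C"
      using s by simp
    then have "norm (T (z - w)) \<le> (1 + \<delta>) * diameter C"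
      using \<delta> by (simp add: Tdiff s_def inverse_eq_divide pos_divide_le_eq mult.commute)
    moreover have "norm (z - w) \<le> (1 + \<delta>) * norm (T (z - w))"
      using Tge[of "z - w"] zw E(2) \<delta> by (simp add: subspace_diff field_simps)
    ultimately show ?thesis
      using \<delta> by (meson add_pos_pos less_imp_le mult_left_mono order_trans zero_less_one)
  qed
  have "((\<lambda>\<delta>. (1 + \<delta>) * c i) \<longlongrightarrow> (1 + 0) * c i) (at_right (0::real))" for i
    by (intro tendsto_intros)
  then have tends: "((\<lambda>\<delta>. (1 + \<delta>) * c i) \<longlongrightarrow> c i) (at_right (0::real))" for i
    by simp
  have "\<forall>\<^sub>F \<delta> in at_right 0. \<forall>i\<in>{..<n}. (1 + \<delta>) * c i < g i (x i) \<and> (1 + \<delta>) * c i < g i (x' i)"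
    using x(2) x'(2)
    by (intro eventually_ball_finite ballI eventually_conj order_tendstoD(2)[OF tends]) auto
  moreover have "\<forall>\<^sub>F \<delta> in at_right (0::real). 0 < \<delta>"
    by (rule eventually_at_right_less)
  ultimately have "\<forall>\<^sub>F \<delta> in at_right 0. norm (z - w) \<le> (1 + \<delta>) * ((1 + \<delta>) * diameter C)"
    by eventually_elim (rule bound, auto)
  moreover have "((\<lambda>\<delta>. (1 + \<delta>) * ((1 + \<delta>) * diameter C)) \<longlongrightarrow> (1 + 0) * ((1 + 0) * diameter C))
      (at_right (0::real))"
    by (intro tendsto_intros)
  ultimately have "norm (z - w) \<le> (1 + 0) * ((1 + 0) * diameter C)"
    by (intro tendsto_lowerbound) auto
  then show "norm (z - w) \<le> diameter C"
    by simp
qed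

theorem proposition2p13:
  fixes Y :: "'a::banach set"
  assumes "subspace Y" and "closed Y" and "Y \<noteq> {0}"
    and "ai_ideal Y"
    and "BSCSP_on Y"
  shows "BSCSP_on (UNIV :: 'a set)"
  unfolding BSCSP_on_def
proof (intro allI impI)
  fix \<epsilon> :: real assume "\<epsilon> > 0"
  then obtain C where "convex_combination_of_slices_on Y C" and dC: "diameter C < \<epsilon>"
    using assms(5) unfolding BSCSP_on_def by blast
  then obtain n :: nat and l S where S: "\<forall>i<n. is_slice_on Y (S i)"
    and l: "\<forall>i<n. l i > 0" "(\<Sum>i<n. l i) = 1"
    and C: "C = {(\<Sum>i<n. l i *\<^sub>R x i) | x. \<forall>i<n. x i \<in> S i}"
    unfolding convex_combination_of_slices_on_def by blast
  obtain f \<alpha> where f: "\<And>i. i < n \<Longrightarrow> bounded_functional_on Y (f i)"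
      "\<And>i. i < n \<Longrightarrow> dual_norm_on Y (f i) = 1"
    and \<alpha>: "\<And>i. i < n \<Longrightarrow> \<alpha> i > 0" and Seq: "\<And>i. i < n \<Longrightarrow> S i = slice_on Y (f i) (\<alpha> i)"
    using S unfolding is_slice_on_def by metis
  obtain G \<phi> where G: "G \<noteq> bot"
    and ev: "\<And>E \<epsilon>. \<lbrakk>finite_dim_subspace E; \<epsilon> > 0\<rbrakk> \<Longrightarrow> \<forall>\<^sub>F T in G. T \<in> ai_operators Y E \<epsilon>"
    and lim: "\<And>f x. (\<And>y. y \<in> Y \<Longrightarrow> \<bar>f y\<bar> \<le> norm y) \<Longrightarrow> ((\<lambda>T. f (T x)) \<longlongrightarrow> \<phi> f x) G"
    using ai_ideal_limits[OF assms(4)] by blast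
  define g where "g i = \<phi> (f i)" for i
  have limg: "((\<lambda>T. f i (T x)) \<longlongrightarrow> g i x) G" if "i < n" for i x
    unfolding g_def using abs_le_dual_norm_on[OF assms(1) f(1)[OF that]] f(2)[OF that]
    by (intro lim) simp
  have g: "bounded_functional_on UNIV (g i)" "dual_norm_on UNIV (g i) = 1" if "i < n" for i
    using limit_functional_norm_preserving_extension[OF assms(1) f[OF that] G ev limg[OF that]]
    by blast+
  define D where "D = {(\<Sum>i<n. l i *\<^sub>R x i) | x. \<forall>i<n. x i \<in> slice_on UNIV (g i) (\<alpha> i)}"
  have "diameter D \<le> diameter C"
  proof (rule diameter_combination_le[OF assms(1) _ G ev limg])
    show "lin_map_on Y (f i)" if "i < n" for i
      using f(1)[OF that] by (simp add: bounded_functional_on_def)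
    show "C = {(\<Sum>i<n. l i *\<^sub>R y i) | y. \<forall>i<n. y i \<in> {y \<in> unit_ball_on Y. 1 - \<alpha> i < f i y}}"
      unfolding C using Seq f by (simp add: slice_on_eq[OF assms(1)])
    show "D = {(\<Sum>i<n. l i *\<^sub>R x i) | x. \<forall>i<n. x i \<in> {x \<in> unit_ball_on UNIV. 1 - \<alpha> i < g i x}}"
      unfolding D_def using g by (simp add: slice_on_eq[OF subspace_UNIV])
  qed
  moreover have "convex_combination_of_slices_on UNIV D"
    unfolding convex_combination_of_slices_on_def is_slice_on_def D_def
    using g \<alpha> l by (intro exI[of _ n] exI[of _ l] exI[of _ "\<lambda>i. slice_on UNIV (g i) (\<alpha> i)"]) blast
  ultimately show "\<exists>C. convex_combination_of_slices_on (UNIV :: 'a set) C \<and> diameter C < \<epsilon>"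
    using dC by (meson order_le_less_trans)
qed

end
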